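(* Let $S(\rho)$ be the shingle set of the canonical proposal text of a proposal $\rho$ under a fixed tokenisation, let $S_{\mathrm{cons}}$ be the consensus shingle set of the delivered group, and let the admissibility test for agent $i$ be $$|S(\rho_i)\cap S_{\mathrm{cons}}|\cdot q\;\ge\;p\cdot|S(\rho_i)\cup S_{\mathrm{cons}}|$$ for a fixed rational threshold $p/q$. Then the predicate's value, and the identity of the selected core, are computable by exact integer arithmetic over byte strings. Two honest nodes with the same delivered view obtain the same result on any conforming platform, with no assumption on floating-point behaviour, kernel selection, reduction order, or library version.
   Context: A delivered view is a finite family of structured proposals $(\rho_i)_{i\in I_r}$ indexed by agent ids. Each $\rho_i$ has a canonical proposal text, a byte string that is a byte-deterministic serialisation of its structured fields. Tokenisation and shingling are fixed functions from byte strings to finite sets of byte strings; $S(\rho_i)$ is the resulting finite set. The consensus shingle set $S_{\mathrm{cons}}$ is a set determined from the shingle sets of the group's proposals by a fixed counting rule (the shingles occurring in more than half of the proposals). $p,q$ are fixed integers with $q>0$. The selected core is the largest subset of agents satisfying the test, with ties broken by agent id. *)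

theory Defs
  imports Complex_Main "HOL-Library.Multiset" "HOL-Library.Finite_Map" "HOL-Library.Word"
begin

type_synonym bytes = "8 word list"

text \<open>
  A delivered view is a finite family of proposals indexed by agent ids. The parameters
  \<open>canon\<close> (canonical proposal text of a structured proposal) and \<open>shingle\<close> (tokenisation
  followed by shingling) are arbitrary but fixed throughout.
\<close>

type_synonym ('id, 'prop) view = "('id, 'prop) fmap"

definition shingle_set :: "('prop \<Rightarrow> bytes) \<Rightarrow> (bytes \<Rightarrow> bytes fset) \<Rightarrow> 'prop \<Rightarrow> bytes set" where
  "shingle_set canon shingle \<rho> = fset (shingle (canon \<rho>))"

definition shingles_at ::
  "('prop \<Rightarrow> bytes) \<Rightarrow> (bytes \<Rightarrow> bytes fset) \<Rightarrow> ('id, 'prop) view \<Rightarrow> 'id \<Rightarrow> bytes set" where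
  "shingles_at canon shingle V i = shingle_set canon shingle (the (fmlookup V i))"

definition consensus_set ::
  "('prop \<Rightarrow> bytes) \<Rightarrow> (bytes \<Rightarrow> bytes fset) \<Rightarrow> ('id, 'prop) view \<Rightarrow> bytes set" where
  "consensus_set canon shingle V =
     {s. 2 * card {i \<in> fmdom' V. s \<in> shingles_at canon shingle V i} > card (fmdom' V)}"

definition admissible ::
  "('prop \<Rightarrow> bytes) \<Rightarrow> (bytes \<Rightarrow> bytes fset) \<Rightarrow> int \<Rightarrow> int \<Rightarrow> ('id, 'prop) view \<Rightarrow> 'id \<Rightarrow> bool" where
  "admissible canon shingle p q V i \<longleftrightarrow>
     int (card (shingles_at canon shingle V i \<inter> consensus_set canon shingle V)) * q
       \<ge> p * int (card (shingles_at canon shingle V i \<union> consensus_set canon shingle V))"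

definition passing_subset ::
  "('prop \<Rightarrow> bytes) \<Rightarrow> (bytes \<Rightarrow> bytes fset) \<Rightarrow> int \<Rightarrow> int \<Rightarrow> ('id, 'prop) view \<Rightarrow> 'id set \<Rightarrow> bool" where
  "passing_subset canon shingle p q V C \<longleftrightarrow>
     C \<subseteq> fmdom' V \<and> (\<forall>i\<in>C. admissible canon shingle p q V i)"

text \<open>
  Largest cardinality first; among subsets of equal cardinality, the one whose increasing list
  of agent ids is lexicographically least.
\<close>

definition is_selected_core ::
  "('prop \<Rightarrow> bytes) \<Rightarrow> (bytes \<Rightarrow> bytes fset) \<Rightarrow> int \<Rightarrow> int
     \<Rightarrow> ('id :: linorder, 'prop) view \<Rightarrow> 'id set \<Rightarrow> bool" where
  "is_selected_core canon shingle p q V C \<longleftrightarrow>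
     passing_subset canon shingle p q V C \<and>
     (\<forall>D. passing_subset canon shingle p q V D \<and> D \<noteq> C \<longrightarrow>
        card D < card C \<or>
        card D = card C \<and>
          (sorted_list_of_set C, sorted_list_of_set D) \<in> lexord {(x, y). x < y})"

text \<open>
  Programs are integer-valued terms. \<open>Sum_agents e\<close> sums \<open>e\<close> over the agents of the
  delivered view, and \<open>Sum_shingles a e\<close> over the shingles of the proposal of agent variable
  \<open>a\<close>. Agent variables and shingle variables are two separate families of de Bruijn indices;
  each sum binds index 0 of its own family. \<open>Leq\<close>, \<open>Bytes_eq\<close> and \<open>Id_leq\<close> return 1 or 0.
  \<open>Float_op\<close> is a call to a numerical routine of the platform.
\<close>

datatype expr =
    Const int
  | Add expr expr
  | Sub expr expr
  | Mul expr expr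
  | Leq expr expr
  | Bytes_eq nat nat
  | Id_leq nat nat
  | Sum_agents expr
  | Sum_shingles nat expr
  | Float_op nat expr expr

primrec exact :: "expr \<Rightarrow> bool" where
  "exact (Const c) \<longleftrightarrow> True"
| "exact (Add a b) \<longleftrightarrow> exact a \<and> exact b"
| "exact (Sub a b) \<longleftrightarrow> exact a \<and> exact b"
| "exact (Mul a b) \<longleftrightarrow> exact a \<and> exact b"
| "exact (Leq a b) \<longleftrightarrow> exact a \<and> exact b"
| "exact (Bytes_eq s t) \<longleftrightarrow> True"
| "exact (Id_leq i j) \<longleftrightarrow> True"
| "exact (Sum_agents e) \<longleftrightarrow> exact e"
| "exact (Sum_shingles i e) \<longleftrightarrow> exact e"
| "exact (Float_op f a b) \<longleftrightarrow> False"

text \<open>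
  A reduction schedule fixes both the order and the bracketing in which the operands of a sum
  are combined.
\<close>

datatype schedule = Zero | Operand int | Combine schedule schedule

primrec operands :: "schedule \<Rightarrow> int multiset" where
  "operands Zero = {#}"
| "operands (Operand x) = {#x#}"
| "operands (Combine s t) = operands s + operands t"

primrec reduce :: "(int \<Rightarrow> int \<Rightarrow> int) \<Rightarrow> schedule \<Rightarrow> int" where
  "reduce add Zero = 0"
| "reduce add (Operand x) = x"
| "reduce add (Combine s t) = add (reduce add s) (reduce add t)"

text \<open>
  Set-valued components list the behaviours among which a platform may choose afresh each time
  the operation is executed: the iteration order of a finite set, the schedule of a reduction,
  the kernel that serves a numerical call and the rounded result that it delivers. The arguments
  of \<open>float_routine\<close> are the library version, the kernel, the routine and two operands.
\<close>

record ('id, 'prop) platform =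
  int_add :: "int \<Rightarrow> int \<Rightarrow> int"
  int_sub :: "int \<Rightarrow> int \<Rightarrow> int"
  int_mul :: "int \<Rightarrow> int \<Rightarrow> int"
  int_leq :: "int \<Rightarrow> int \<Rightarrow> bool"
  bytes_eq :: "bytes \<Rightarrow> bytes \<Rightarrow> bool"
  id_leq :: "'id \<Rightarrow> 'id \<Rightarrow> bool"
  serialise :: "'prop \<Rightarrow> bytes"
  list_shingles :: "bytes \<Rightarrow> bytes list set"
  list_agents :: "'id fset \<Rightarrow> 'id list set"
  schedules :: "int list \<Rightarrow> schedule set"
  library_version :: nat
  kernels :: "nat set"
  float_routine :: "nat \<Rightarrow> nat \<Rightarrow> nat \<Rightarrow> int \<Rightarrow> int \<Rightarrow> int set"

definition enumerates :: "'a list set \<Rightarrow> 'a fset \<Rightarrow> bool" where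
  "enumerates X A \<longleftrightarrow> X \<noteq> {} \<and> (\<forall>xs\<in>X. distinct xs \<and> set xs = fset A)"

text \<open>
  Conformity constrains the exact operations only: \<open>library_version\<close>, \<open>kernels\<close> and
  \<open>float_routine\<close> do not occur below, iteration orders are arbitrary, and a schedule need only
  use each operand exactly once.
\<close>

definition conforming ::
  "('prop \<Rightarrow> bytes) \<Rightarrow> (bytes \<Rightarrow> bytes fset) \<Rightarrow> ('id :: linorder, 'prop) platform \<Rightarrow> bool" where
  "conforming canon shingle P \<longleftrightarrow>
     (\<forall>x y. int_add P x y = x + y) \<and>
     (\<forall>x y. int_sub P x y = x - y) \<and>
     (\<forall>x y. int_mul P x y = x * y) \<and>
     (\<forall>x y. int_leq P x y \<longleftrightarrow> x \<le> y) \<and>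
     (\<forall>s t. bytes_eq P s t \<longleftrightarrow> s = t) \<and>
     (\<forall>i j. id_leq P i j \<longleftrightarrow> i \<le> j) \<and>
     (\<forall>\<rho>. serialise P \<rho> = canon \<rho>) \<and>
     (\<forall>b. enumerates (list_shingles P b) (shingle b)) \<and>
     (\<forall>A. enumerates (list_agents P A) A) \<and>
     (\<forall>vs. schedules P vs \<noteq> {} \<and> (\<forall>t\<in>schedules P vs. operands t = mset vs))"

text \<open>
  Possible results of summing over the listed elements, where \<open>R x\<close> is the set of possible
  values of the summand at \<open>x\<close>.
\<close>

definition sum_results ::
  "('id, 'prop) platform \<Rightarrow> 'a list set \<Rightarrow> ('a \<Rightarrow> int set) \<Rightarrow> int set" where
  "sum_results P X R =
     {reduce (int_add P) t | t vs xs. xs \<in> X \<and> vs \<in> listset (map R xs) \<and> t \<in> schedules P vs}"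

text \<open>
  All possible results of running a program on a platform, for given values of the free agent
  and shingle variables; an unbound variable or an agent outside the view yields no result.
\<close>

primrec eval ::
  "('id, 'prop) platform \<Rightarrow> ('id, 'prop) view \<Rightarrow> expr \<Rightarrow> 'id list \<Rightarrow> bytes list \<Rightarrow> int set" where
  "eval P V (Const c) as ss = {c}"
| "eval P V (Add a b) as ss = {int_add P x y | x y. x \<in> eval P V a as ss \<and> y \<in> eval P V b as ss}"
| "eval P V (Sub a b) as ss = {int_sub P x y | x y. x \<in> eval P V a as ss \<and> y \<in> eval P V b as ss}"
| "eval P V (Mul a b) as ss = {int_mul P x y | x y. x \<in> eval P V a as ss \<and> y \<in> eval P V b as ss}"
| "eval P V (Leq a b) as ss =
     {of_bool (int_leq P x y) | x y. x \<in> eval P V a as ss \<and> y \<in> eval P V b as ss}"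
| "eval P V (Bytes_eq s t) as ss =
     (if s < length ss \<and> t < length ss then {of_bool (bytes_eq P (ss ! s) (ss ! t))} else {})"
| "eval P V (Id_leq i j) as ss =
     (if i < length as \<and> j < length as then {of_bool (id_leq P (as ! i) (as ! j))} else {})"
| "eval P V (Sum_agents e) as ss =
     sum_results P (list_agents P (fmdom V)) (\<lambda>i. eval P V e (i # as) ss)"
| "eval P V (Sum_shingles i e) as ss =
     (if i < length as then
        (case fmlookup V (as ! i) of
           None \<Rightarrow> {}
         | Some \<rho> \<Rightarrow>
             sum_results P (list_shingles P (serialise P \<rho>)) (\<lambda>s. eval P V e as (s # ss)))
      else {})"
| "eval P V (Float_op f a b) as ss =
     (\<Union>x\<in>eval P V a as ss. \<Union>y\<in>eval P V b as ss. \<Union>k\<in>kernels P.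
        float_routine P (library_version P) k f x y)"

text \<open>
  A program with one free agent variable decides a property of agents (a nonzero result meaning
  true), and selects the set of agents of the view for which a run of it returned true.
\<close>

definition decisions ::
  "('id, 'prop) platform \<Rightarrow> ('id, 'prop) view \<Rightarrow> expr \<Rightarrow> 'id \<Rightarrow> bool set" where
  "decisions P V e i = (\<lambda>x. x \<noteq> 0) ` eval P V e [i] []"

definition selections ::
  "('id, 'prop) platform \<Rightarrow> ('id, 'prop) view \<Rightarrow> expr \<Rightarrow> 'id set set" where
  "selections P V e =
     {{i \<in> fmdom' V. b i} | b. \<forall>i\<in>fmdom' V. b i \<in> decisions P V e i}"

record ('id, 'prop) node =
  node_platform :: "('id, 'prop) platform"
  node_view :: "('id, 'prop) view"
  node_verdicts :: "('id, bool) fmap"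
  node_core :: "'id set"

definition honest ::
  "('prop \<Rightarrow> bytes) \<Rightarrow> (bytes \<Rightarrow> bytes fset) \<Rightarrow> expr \<Rightarrow> expr
     \<Rightarrow> ('id :: linorder, 'prop) node \<Rightarrow> bool" where
  "honest canon shingle test_prog core_prog n \<longleftrightarrow>
     conforming canon shingle (node_platform n) \<and>
     fmdom (node_verdicts n) = fmdom (node_view n) \<and>
     (\<forall>i b. fmlookup (node_verdicts n) i = Some b \<longrightarrow>
        b \<in> decisions (node_platform n) (node_view n) test_prog i) \<and>
     node_core n \<in> selections (node_platform n) (node_view n) core_prog"

end

(* The admissibility test is applied to each agent separately, so the passing subsets are exactly
   the subsets of the set of all admissible agents, and the largest of them is that whole set: it is
   the unique selected core, and the program for the test also selects the core.

   For the test itself only the size of the consensus set needs an idea. Summing over agents and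
   their shingles meets a shingle once per holder, and there is no division; instead a shingle is
   counted only at its holder of least id, that is, at the holder j for which at most one agent
   k \<le> j holds it. *)

theory Submission
  imports Defs
begin

section \<open>Sums on conforming platforms\<close>

text \<open>Exact addition is associative and commutative, so order and bracketing of a reduction
  leave no trace beyond the multiset of operands.\<close>

lemma reduce_plus: "reduce (+) t = sum_mset (operands t)"
  by (induction t) auto

lemma listset_singletons:
  assumes "\<And>x. x \<in> set xs \<Longrightarrow> R x = {r x}"
  shows "listset (map R xs) = {map r xs}"
  using assms by (induction xs) (auto simp: set_Cons_def)

text \<open>Every enumeration of the set and every schedule leads to the same multiset of summands,
  so all runs agree by \<open>reduce_plus\<close>. Equality with a singleton, rather than inclusion,
  also takes one actual run: \<open>enumerates\<close> and \<open>conforming\<close> guarantee that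
  an enumeration and a schedule exist.\<close>

lemma sum_results_eq:
  assumes "conforming canon shingle P" and "enumerates X A"
    and R: "\<And>x. x \<in> fset A \<Longrightarrow> R x = {r x}"
  shows "sum_results P X R = {\<Sum>x\<in>fset A. r x}"
proof -
  have add: "int_add P = (+)"
    using assms(1) by (auto simp: conforming_def)
  have sched: "schedules P vs \<noteq> {}" "t \<in> schedules P vs \<Longrightarrow> operands t = mset vs" for t vs
    using assms(1) by (auto simp: conforming_def)
  have X: "X \<noteq> {}" "xs \<in> X \<Longrightarrow> distinct xs \<and> set xs = fset A" for xs
    using assms(2) by (auto simp: enumerates_def)
  have red: "reduce (int_add P) t = (\<Sum>x\<in>fset A. r x)"
    if "xs \<in> X" "t \<in> schedules P (map r xs)" for t xs
    using that X(2)[of xs] sched(2)[OF that(2)]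
    by (simp add: add reduce_plus sum_mset_sum_list sum_list_distinct_conv_sum_set del: mset_map)
  have ls: "listset (map R xs) = {map r xs}" if "xs \<in> X" for xs
    using X(2)[OF that] R by (intro listset_singletons) auto
  obtain xs where xs: "xs \<in> X" using X(1) by auto
  obtain t where t: "t \<in> schedules P (map r xs)" using sched(1) by blast
  have "(\<Sum>x\<in>fset A. r x) \<in> sum_results P X R"
    unfolding sum_results_def using red[OF xs t] ls[OF xs] xs t
    by (metis (mono_tags, lifting) mem_Collect_eq singletonI)
  moreover have "sum_results P X R \<subseteq> {\<Sum>x\<in>fset A. r x}"
    unfolding sum_results_def using red ls by auto
  ultimately show ?thesis by auto
qed

lemma eval_Sum_agents:
  assumes "conforming canon shingle P"
    and "\<And>k. k \<in> fmdom' V \<Longrightarrow> eval P V e (k # as) ss = {r k}"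
  shows "eval P V (Sum_agents e) as ss = {\<Sum>k\<in>fmdom' V. r k}"
proof -
  have "enumerates (list_agents P (fmdom V)) (fmdom V)"
    using assms(1) by (auto simp: conforming_def)
  from sum_results_eq[OF assms(1) this] assms(2) show ?thesis
    by (simp add: fmdom'_alt_def)
qed

lemma eval_Sum_shingles:
  assumes "conforming canon shingle P" and "i < length as" and "as ! i \<in> fmdom' V"
    and "\<And>s. s \<in> shingles_at canon shingle V (as ! i) \<Longrightarrow> eval P V e as (s # ss) = {r s}"
  shows "eval P V (Sum_shingles i e) as ss = {\<Sum>s\<in>shingles_at canon shingle V (as ! i). r s}"
proof -
  obtain \<rho> where \<rho>: "fmlookup V (as ! i) = Some \<rho>"
    using assms(3) by (auto simp: fmlookup_dom'_iff)
  have "enumerates (list_shingles P (serialise P \<rho>)) (shingle (canon \<rho>))"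
    using assms(1) by (auto simp: conforming_def)
  from sum_results_eq[OF assms(1) this] assms(2,4) \<rho> show ?thesis
    by (simp add: shingles_at_def shingle_set_def)
qed

section \<open>Counting the consensus set\<close>

lemma finite_shingles_at [simp]: "finite (shingles_at canon shingle V i)"
  by (simp add: shingles_at_def shingle_set_def)

text \<open>A strict majority is positive even for the empty view, so each consensus shingle has a
  holder. This bounds a set that is defined by a comprehension over all byte strings and makes it
  finite.\<close>

lemma consensus_set_subset:
  "consensus_set canon shingle V \<subseteq> (\<Union>i\<in>fmdom' V. shingles_at canon shingle V i)"
proof
  fix s assume "s \<in> consensus_set canon shingle V"
  then have "card {i \<in> fmdom' V. s \<in> shingles_at canon shingle V i} \<noteq> 0"
    unfolding consensus_set_def mem_Collect_eq by linarith
  then have "{i \<in> fmdom' V. s \<in> shingles_at canon shingle V i} \<noteq> {}"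
    by (metis card.empty)
  then show "s \<in> (\<Union>i\<in>fmdom' V. shingles_at canon shingle V i)"
    by auto
qed

lemma finite_consensus_set [simp]: "finite (consensus_set canon shingle V)"
  by (rule finite_subset[OF consensus_set_subset]) auto

text \<open>The pairs of a first holder and its element project bijectively onto \<open>C\<close>.
  Since \<open>j\<close> itself is counted among the holders up to \<open>j\<close>, the bound 1
  says that no holder precedes it.\<close>

lemma card_eq_sum_first_holders:
  fixes D :: "'i :: linorder set"
  assumes "finite D" and "\<And>j. j \<in> D \<Longrightarrow> finite (S j)" and "C \<subseteq> (\<Union>j\<in>D. S j)"
  shows "card C = (\<Sum>j\<in>D. card {s \<in> S j. s \<in> C \<and> card {k \<in> D. k \<le> j \<and> s \<in> S k} \<le> 1})"
    (is "_ = (\<Sum>j\<in>D. card (?F j))")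
proof -
  have "inj_on snd (Sigma D ?F)"
  proof (rule inj_onI, clarsimp)
    fix j j' s
    assume *: "j \<in> D" "j' \<in> D" "s \<in> S j" "s \<in> S j'"
      "card {k \<in> D. k \<le> j \<and> s \<in> S k} \<le> Suc 0" "card {k \<in> D. k \<le> j' \<and> s \<in> S k} \<le> Suc 0"
    \<comment> \<open>Both \<open>l\<close> and \<open>l'\<close> lie in the set of holders up to
      \<open>l'\<close>, which has at most one element.\<close>
    have uniq: "l = l'" if "l \<le> l'" "l \<in> D" "l' \<in> D" "s \<in> S l" "s \<in> S l'"
      "card {k \<in> D. k \<le> l' \<and> s \<in> S k} \<le> Suc 0" for l l'
      using that assms(1) card_le_Suc0_iff_eq[of "{k \<in> D. k \<le> l' \<and> s \<in> S k}"] by auto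
    show "j = j'"
    proof (cases j j' rule: linorder_le_cases)
      case le
      then show ?thesis by (rule uniq) (use * in auto)
    next
      case ge
      then show ?thesis by (rule uniq[symmetric]) (use * in auto)
    qed
  qed
  moreover have "snd ` Sigma D ?F = C"
  proof (rule antisym; rule subsetI)
    fix s assume s: "s \<in> C"
    \<comment> \<open>The least holder is the preimage of \<open>s\<close> under the
      projection.\<close>
    define j where "j = Min {k \<in> D. s \<in> S k}"
    have fin: "finite {k \<in> D. s \<in> S k}" using assms(1) by simp
    have "{k \<in> D. s \<in> S k} \<noteq> {}" using s assms(3) by auto
    from Min_in[OF fin this] have j: "j \<in> D" "s \<in> S j" by (auto simp: j_def)
    have "k = j" if "k \<in> D" "s \<in> S k" "k \<le> j" for k
      using Min_le[OF fin, of k] that by (simp add: j_def)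
    with j have "{k \<in> D. k \<le> j \<and> s \<in> S k} = {j}"
      by blast
    then have "card {k \<in> D. k \<le> j \<and> s \<in> S k} \<le> 1"
      by simp
    with s j have "(j, s) \<in> Sigma D ?F" by auto
    then show "s \<in> snd ` Sigma D ?F" by (rule rev_image_eqI) simp
  qed auto
  ultimately have "card C = card (Sigma D ?F)"
    using card_image by fastforce
  also have "\<dots> = (\<Sum>j\<in>D. card (?F j))"
    using assms by (intro card_SigmaI) auto
  finally show ?thesis .
qed

section \<open>A program for the admissibility test\<close>

text \<open>The shingle under test is free variable 0 outside the sum, hence index 1 inside it. The
  result is 0 or 1 because the shingles of a proposal form a set.\<close>

definition holds_prog :: expr where
  "holds_prog = Sum_shingles 0 (Bytes_eq 0 1)"

text \<open>The strict majority \<open>n < 2 * h\<close> is written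
  \<open>n + 1 \<le> 2 * h\<close>. \<open>Sum_agents\<close> binds the agent variable of
  \<open>holds_prog\<close>, so only shingle variable 0 stays free and the program can be used under
  any agent environment.\<close>

definition consensus_prog :: expr where
  "consensus_prog =
     Leq (Add (Sum_agents (Const 1)) (Const 1)) (Mul (Const 2) (Sum_agents holds_prog))"

text \<open>Inside the sum, index 0 is the competing agent and index 1 the candidate first holder. A
  product of 0/1 values serves as conjunction.\<close>

definition first_holder_prog :: expr where
  "first_holder_prog = Leq (Sum_agents (Mul (Id_leq 0 1) holds_prog)) (Const 1)"

definition consensus_size_prog :: expr where
  "consensus_size_prog = Sum_agents (Sum_shingles 0 (Mul consensus_prog first_holder_prog))"

definition overlap_prog :: expr where
  "overlap_prog = Sum_shingles 0 consensus_prog"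

text \<open>The size of the union is obtained by inclusion-exclusion from three sizes that sums can
  count.\<close>

definition admissible_prog :: "int \<Rightarrow> int \<Rightarrow> expr" where
  "admissible_prog p q =
     Leq (Mul (Const p)
           (Sub (Add (Sum_shingles 0 (Const 1)) consensus_size_prog) overlap_prog))
         (Mul overlap_prog (Const q))"

lemmas prog_defs = holds_prog_def consensus_prog_def first_holder_prog_def
  consensus_size_prog_def overlap_prog_def admissible_prog_def

lemma exact_admissible_prog: "exact (admissible_prog p q)"
  by (simp add: prog_defs)

context
  fixes canon :: "'prop \<Rightarrow> bytes" and shingle :: "bytes \<Rightarrow> bytes fset"
    and P :: "('id :: linorder, 'prop) platform"
  assumes conf: "conforming canon shingle P"
begin

lemma conforming_ops [simp]:
  "int_add P x y = x + y" "int_sub P x y = x - y" "int_mul P x y = x * y"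
  "int_leq P x y \<longleftrightarrow> x \<le> y" "bytes_eq P s t \<longleftrightarrow> s = t" "id_leq P i j \<longleftrightarrow> i \<le> j"
  using conf by (auto simp: conforming_def)

lemma eval_holds_prog:
  assumes "k \<in> fmdom' V"
  shows "eval P V holds_prog (k # as) (s # ss) = {of_bool (s \<in> shingles_at canon shingle V k)}"
proof -
  have "eval P V holds_prog (k # as) (s # ss)
      = {\<Sum>u\<in>shingles_at canon shingle V k. of_bool (u = s)}"
    unfolding holds_prog_def
    using eval_Sum_shingles[OF conf, of 0 "k # as" V _ "s # ss" "\<lambda>u. of_bool (u = s)"] assms
    by simp
  then show ?thesis
    by (simp add: of_bool_def)
qed

lemma eval_consensus_prog:
  "eval P V consensus_prog as (s # ss) = {of_bool (s \<in> consensus_set canon shingle V)}"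
proof -
  have "eval P V (Sum_agents holds_prog) as (s # ss)
      = {\<Sum>k\<in>fmdom' V. of_bool (s \<in> shingles_at canon shingle V k)}"
    by (rule eval_Sum_agents[OF conf]) (rule eval_holds_prog)
  then have holders: "eval P V (Sum_agents holds_prog) as (s # ss)
      = {int (card {k \<in> fmdom' V. s \<in> shingles_at canon shingle V k})}"
    by (simp add: Collect_conj_eq)
  have "eval P V (Sum_agents (Const 1)) as (s # ss) = {\<Sum>k\<in>fmdom' V. 1}"
    by (rule eval_Sum_agents[OF conf]) simp
  then have agents: "eval P V (Sum_agents (Const 1)) as (s # ss) = {int (card (fmdom' V))}"
    by simp
  show ?thesis
    using holders agents
    by (auto simp: consensus_prog_def consensus_set_def simp del: eval.simps(8))
qed

lemma eval_first_holder_prog: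
  "eval P V first_holder_prog (j # as) (s # ss)
     = {of_bool (card {k \<in> fmdom' V. k \<le> j \<and> s \<in> shingles_at canon shingle V k} \<le> 1)}"
proof -
  have "eval P V (Sum_agents (Mul (Id_leq 0 1) holds_prog)) (j # as) (s # ss)
      = {\<Sum>k\<in>fmdom' V. of_bool (k \<le> j \<and> s \<in> shingles_at canon shingle V k)}"
    by (rule eval_Sum_agents[OF conf]) (simp add: eval_holds_prog of_bool_conj)
  then have "eval P V (Sum_agents (Mul (Id_leq 0 1) holds_prog)) (j # as) (s # ss)
      = {int (card {k \<in> fmdom' V. k \<le> j \<and> s \<in> shingles_at canon shingle V k})}"
    by (simp add: Collect_conj_eq)
  then show ?thesis
    by (auto simp: first_holder_prog_def simp del: eval.simps(8))
qed

lemma eval_overlap_prog: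
  assumes "i \<in> fmdom' V"
  shows "eval P V overlap_prog (i # as) ss
    = {int (card (shingles_at canon shingle V i \<inter> consensus_set canon shingle V))}"
proof -
  have "eval P V overlap_prog (i # as) ss
      = {\<Sum>s\<in>shingles_at canon shingle V i. of_bool (s \<in> consensus_set canon shingle V)}"
    unfolding overlap_prog_def
    using eval_Sum_shingles[OF conf, of 0 "i # as"] assms eval_consensus_prog by simp
  then show ?thesis
    by simp
qed

lemma eval_consensus_size_prog:
  "eval P V consensus_size_prog as ss = {int (card (consensus_set canon shingle V))}"
proof -
  let ?S = "shingles_at canon shingle V" and ?C = "consensus_set canon shingle V"
  let ?Q = "\<lambda>j s. s \<in> ?C \<and> card {k \<in> fmdom' V. k \<le> j \<and> s \<in> ?S k} \<le> 1"
  have body: "eval P V (Mul consensus_prog first_holder_prog) (j # as) (s # ss)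
      = {of_bool (?Q j s)}" for j s
    by (simp add: eval_consensus_prog eval_first_holder_prog of_bool_conj)
  have "eval P V (Sum_shingles 0 (Mul consensus_prog first_holder_prog)) (j # as) ss
      = {\<Sum>s\<in>?S j. of_bool (?Q j s)}" if "j \<in> fmdom' V" for j
    using eval_Sum_shingles[OF conf, of 0 "j # as" V _ ss, OF _ _ body] that by simp
  then have "eval P V consensus_size_prog as ss
      = {\<Sum>j\<in>fmdom' V. \<Sum>s\<in>?S j. of_bool (?Q j s)}"
    unfolding consensus_size_prog_def by (rule eval_Sum_agents[OF conf])
  also have "(\<Sum>j\<in>fmdom' V. \<Sum>s\<in>?S j. of_bool (?Q j s))
      = int (\<Sum>j\<in>fmdom' V. card {s \<in> ?S j. ?Q j s})"
    by (simp add: Collect_conj_eq)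
  also have "(\<Sum>j\<in>fmdom' V. card {s \<in> ?S j. ?Q j s}) = card ?C"
    by (rule card_eq_sum_first_holders[symmetric]) (simp_all add: consensus_set_subset)
  finally show ?thesis .
qed

lemma eval_admissible_prog:
  assumes "i \<in> fmdom' V"
  shows "eval P V (admissible_prog p q) [i] [] = {of_bool (admissible canon shingle p q V i)}"
proof -
  let ?S = "shingles_at canon shingle V i" and ?C = "consensus_set canon shingle V"
  have size: "eval P V (Sum_shingles 0 (Const 1)) [i] [] = {int (card ?S)}"
    using eval_Sum_shingles[OF conf, of 0 "[i]" V "Const 1" "[]" "\<lambda>_. 1"] assms by simp
  have union: "int (card (?S \<union> ?C)) = int (card ?S) + int (card ?C) - int (card (?S \<inter> ?C))"
    using card_Un_Int[of ?S ?C] by simp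
  show ?thesis
    using assms size
    by (simp add: admissible_prog_def admissible_def union eval_overlap_prog
          eval_consensus_size_prog del: eval.simps(9))
qed

lemma decisions_admissible_prog:
  "i \<in> fmdom' V \<Longrightarrow>
     decisions P V (admissible_prog p q) i = {admissible canon shingle p q V i}"
  by (simp add: decisions_def eval_admissible_prog)

text \<open>Each agent of the view has exactly one possible decision, which determines the Boolean
  function \<open>b\<close> there.\<close>

lemma selections_admissible_prog:
  "selections P V (admissible_prog p q) = {{i \<in> fmdom' V. admissible canon shingle p q V i}}"
  unfolding selections_def by (auto simp: decisions_admissible_prog)

end

section \<open>The selected core\<close>

lemma is_selected_core_iff:
  "is_selected_core canon shingle p q V C \<longleftrightarrow>
     C = {i \<in> fmdom' V. admissible canon shingle p q V i}" (is "_ \<longleftrightarrow> C = ?A")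
proof -
  have fin: "finite ?A" by simp
  have pass: "passing_subset canon shingle p q V D \<longleftrightarrow> D \<subseteq> ?A" for D
    by (auto simp: passing_subset_def)
  have smaller: "card D < card ?A" if "D \<subseteq> ?A" "D \<noteq> ?A" for D
    using that by (intro psubset_card_mono[OF fin]) auto
  show ?thesis
  proof
    assume sel: "is_selected_core canon shingle p q V C"
    show "C = ?A"
    proof (rule ccontr)
      assume ne: "C \<noteq> ?A"
      have "C \<subseteq> ?A"
        using sel unfolding is_selected_core_def pass by (rule conjunct1)
      from smaller[OF this ne] have "card C < card ?A" .
      \<comment> \<open>The full admissible set is itself a passing subset different from
        \<open>C\<close>, so it is a competitor that \<open>C\<close> must match in size.\<close>
      moreover have "card ?A < card C \<or> card ?A = card C"
        using sel ne unfolding is_selected_core_def pass by blast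
      ultimately show False
        by linarith
    qed
  next
    assume "C = ?A"
    then show "is_selected_core canon shingle p q V C"
      unfolding is_selected_core_def pass by (simp add: smaller)
  qed
qed

lemma honest_nodes_agree:
  assumes "honest canon shingle (admissible_prog p q) (admissible_prog p q) m"
    and "honest canon shingle (admissible_prog p q) (admissible_prog p q) n"
    and "node_view m = node_view n"
  shows "node_verdicts m = node_verdicts n \<and> node_core m = node_core n"
proof -
  have core: "node_core u = {i \<in> fmdom' (node_view u). admissible canon shingle p q (node_view u) i}"
    if "honest canon shingle (admissible_prog p q) (admissible_prog p q) u" for u
    using that by (auto simp: honest_def selections_admissible_prog)
  \<comment> \<open>Verdict maps are compared pointwise: the domain condition in
    \<open>honest\<close> settles where a verdict exists, and the singleton decision set settles its
    value.\<close>
  have verdict: "fmlookup (node_verdicts u) i =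
      (if i \<in> fmdom' (node_view u) then Some (admissible canon shingle p q (node_view u) i)
       else None)"
    if h: "honest canon shingle (admissible_prog p q) (admissible_prog p q) u" for u i
  proof (cases "fmlookup (node_verdicts u) i")
    case None
    with h show ?thesis
      by (metis fmdom'_alt_def fmdom_notI honest_def)
  next
    case (Some b)
    with h have "i \<in> fmdom' (node_view u)"
      by (metis fmdom'_alt_def fmdomI honest_def)
    moreover from h Some have "conforming canon shingle (node_platform u)"
      "b \<in> decisions (node_platform u) (node_view u) (admissible_prog p q) i"
      unfolding honest_def by blast+
    ultimately show ?thesis
      using Some by (simp add: decisions_admissible_prog)
  qed
  show ?thesis
    using core[OF assms(1)] core[OF assms(2)] verdict[OF assms(1)] verdict[OF assms(2)] assms(3)
    by (simp add: fmap_ext)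
qed

theorem propositionF2:
  fixes canon :: "'prop \<Rightarrow> bytes"
    and shingle :: "bytes \<Rightarrow> bytes fset"
    and p q :: int
  assumes "q > 0"
  shows "\<exists>test_prog core_prog.
    exact test_prog \<and> exact core_prog \<and>
    (\<forall>V :: ('id :: linorder, 'prop) view.
       \<exists>!C. is_selected_core canon shingle p q V C) \<and>
    (\<forall>(P :: ('id, 'prop) platform) V. conforming canon shingle P \<longrightarrow>
       (\<forall>i\<in>fmdom' V. decisions P V test_prog i = {admissible canon shingle p q V i}) \<and>
       selections P V core_prog = {C. is_selected_core canon shingle p q V C}) \<and>
    (\<forall>m n :: ('id, 'prop) node.
       honest canon shingle test_prog core_prog m \<and>
       honest canon shingle test_prog core_prog n \<and>
       node_view m = node_view n \<longrightarrow>
       node_verdicts m = node_verdicts n \<and> node_core m = node_core n)"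
\<comment> \<open>One program is the witness twice, since by \<open>is_selected_core_iff\<close>
  membership in the core is the test itself.\<close>
proof (rule exI[of _ "admissible_prog p q"], rule exI[of _ "admissible_prog p q"],
    intro conjI allI impI ballI)
  fix V :: "('id, 'prop) view"
  show "\<exists>!C. is_selected_core canon shingle p q V C"
    by (simp add: is_selected_core_iff)
next
  fix P :: "('id, 'prop) platform" and V
  assume "conforming canon shingle P"
  then show "selections P V (admissible_prog p q) = {C. is_selected_core canon shingle p q V C}"
    by (simp add: is_selected_core_iff selections_admissible_prog)
next
  fix m n :: "('id, 'prop) node"
  assume "honest canon shingle (admissible_prog p q) (admissible_prog p q) m \<and>
    honest canon shingle (admissible_prog p q) (admissible_prog p q) n \<and>
    node_view m = node_view n"
  then have "node_verdicts m = node_verdicts n \<and> node_core m = node_core n"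
    using honest_nodes_agree by blast
  then show "node_verdicts m = node_verdicts n" "node_core m = node_core n"
    by simp_all
qed (simp_all add: exact_admissible_prog decisions_admissible_prog)

end
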